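(* Let $n\geq 2$ be an integer. Then $$\omega\big(\mathcal{G}(\mathbb{Z}_n[x])\big)=\omega\big(\mathcal{G}(\mathbb{Z}_n)\big)=\begin{cases}2 & \text{if } n\neq 3,\\ 3 & \text{if } n=3.\end{cases}$$
   Context: $\mathbb{Z}_n$ denotes the ring of integers modulo $n$. For a commutative ring $R$ with identity, the involutory Cayley graph $\mathcal{G}(R)$ is the simple undirected graph with vertex set $R$ in which two vertices $a,b$ are adjacent if and only if $(a-b)^2=1$. $\omega(G)$ denotes the clique number of a graph $G$, i.e. the cardinality of a largest set of pairwise adjacent vertices. *)

theory Defs
  imports
    "HOL-Number_Theory.Residues"
    "HOL-Algebra.UnivPoly"
    "HOL-Library.Ramsey"
    "HOL-Library.Extended_Nat"
begin

(* A simple undirected graph is a pair (V, E) of a vertex set and a set of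
   two-element subsets of V; V may be infinite. *)
type_synonym 'a sgraph = "'a set \<times> 'a set set"

definition involutory_cayley_graph :: "('a, 'b) ring_scheme \<Rightarrow> 'a sgraph" where
  "involutory_cayley_graph R =
     (carrier R,
      {{a, b} | a b. a \<in> carrier R \<and> b \<in> carrier R \<and> a \<noteq> b \<and>
                     (a \<ominus>\<^bsub>R\<^esub> b) [^]\<^bsub>R\<^esub> (2::nat) = \<one>\<^bsub>R\<^esub>})"

(* Because card is 0 on infinite sets, the supremum ranges over the finite cliques only.
   Subsets of cliques are cliques, so it is \<infinity> exactly when clique sizes are unbounded
   (in particular if there is an infinite clique), and otherwise it is attained. *)
definition clique_number :: "'a sgraph \<Rightarrow> enat" where
  "clique_number G =
     (SUP C \<in> {C. C \<subseteq> fst G \<and> finite C \<and> clique C (snd G)}. enat (card C))"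

lemma clique_number_eq_enat_iff:
  "clique_number G = enat k \<longleftrightarrow>
     (\<exists>C. C \<subseteq> fst G \<and> finite C \<and> clique C (snd G) \<and> card C = k) \<and>
     (\<forall>C. C \<subseteq> fst G \<and> finite C \<and> clique C (snd G) \<longrightarrow> card C \<le> k)"
proof -
  let ?S = "{C. C \<subseteq> fst G \<and> finite C \<and> clique C (snd G)}"
  let ?X = "(\<lambda>C. enat (card C)) ` ?S"
  have ne: "?X \<noteq> {}"
    using null_clique[of "snd G"] by blast
  show ?thesis
  proof
    assume eq: "clique_number G = enat k"
    then have sup: "Sup ?X = enat k"
      by (simp add: clique_number_def)
    have le: "card C \<le> k" if "C \<in> ?S" for C
      using Sup_upper[of "enat (card C)" ?X] that sup by auto
    have "?X \<subseteq> enat ` {..k}"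
      using le by blast
    then have fin: "finite ?X"
      by (rule finite_subset) simp
    then have "Sup ?X = Max ?X"
      using ne by (metis Sup_enat_def)
    with Max_in[OF fin ne] sup have "enat k \<in> ?X"
      by simp
    with le show "(\<exists>C. C \<subseteq> fst G \<and> finite C \<and> clique C (snd G) \<and> card C = k) \<and>
       (\<forall>C. C \<subseteq> fst G \<and> finite C \<and> clique C (snd G) \<longrightarrow> card C \<le> k)"
      by auto
  next
    assume *: "(\<exists>C. C \<subseteq> fst G \<and> finite C \<and> clique C (snd G) \<and> card C = k) \<and>
       (\<forall>C. C \<subseteq> fst G \<and> finite C \<and> clique C (snd G) \<longrightarrow> card C \<le> k)"
    then obtain C where C: "C \<in> ?S" "card C = k"
      by blast
    show "clique_number G = enat k"
      unfolding clique_number_def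
    proof (rule antisym)
      show "Sup ?X \<le> enat k"
        by (rule SUP_least) (use * in auto)
      show "enat k \<le> Sup ?X"
        by (rule SUP_upper2[OF C(1)]) (use C(2) in simp)
    qed
  qed
qed

end

theory Submission
  imports Defs
begin

text \<open>
  Let \<open>a\<close>, \<open>b\<close>, \<open>c\<close> be pairwise adjacent in the involutory Cayley graph of a commutative ring and put
  \<open>u = a - b\<close>, \<open>v = b - c\<close>. Then \<open>u\<^sup>2 = v\<^sup>2 = (u + v)\<^sup>2 = 1\<close>, so \<open>2uv = -1\<close>; squaring this gives
  \<open>4 = 1\<close>. Hence triangles exist only in rings with \<open>3 = 0\<close>
  (\<open>three_eq_zero_if_triangle\<close>), and in every other nontrivial commutative ring
  the edge from \<open>0\<close> to \<open>1\<close> is a maximum clique (\<open>clique_number_two\<close>).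

  If \<open>3 = 0\<close> and the ring is a domain, the only elements of square \<open>1\<close> are \<open>1\<close> and \<open>-1\<close>, so a clique
  through \<open>a\<close> lies in \<open>{a, a + 1, a - 1}\<close>; conversely \<open>{0, 1, -1}\<close> is a clique because
  \<open>1 - (-1) = 2 = -1\<close> (\<open>clique_number_three\<close>).

  The ring of integers modulo \<open>n\<close> is nontrivial and has \<open>3 = 0\<close> exactly for \<open>n = 3\<close>, when it is a
  field. All of this passes to its polynomial ring: the constants embed injectively, and
  polynomials over a domain form a domain.
\<close>

lemma (in cring) nat_pow_two: "x \<in> carrier R \<Longrightarrow> x [^] (2::nat) = x \<otimes> x"
  by (simp add: numeral_2_eq_2)

text \<open>
  An edge is an unordered pair, while the condition on it is written for an ordered one; reading it
  off for a given order of the endpoints rests on \<open>(b - a)\<^sup>2 = (a - b)\<^sup>2\<close>.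
\<close>
lemma (in cring) adjacent_iff:
  "{a, b} \<in> snd (involutory_cayley_graph R) \<longleftrightarrow>
     a \<in> carrier R \<and> b \<in> carrier R \<and> a \<noteq> b \<and> (a \<ominus> b) \<otimes> (a \<ominus> b) = \<one>"
proof -
  have swap: "(b \<ominus> a) \<otimes> (b \<ominus> a) = (a \<ominus> b) \<otimes> (a \<ominus> b)"
    if "a \<in> carrier R" "b \<in> carrier R"
    using that by algebra
  have "{a, b} \<in> snd (involutory_cayley_graph R) \<longleftrightarrow>
      (\<exists>x y. {a, b} = {x, y} \<and> x \<in> carrier R \<and> y \<in> carrier R \<and> x \<noteq> y
        \<and> (x \<ominus> y) \<otimes> (x \<ominus> y) = \<one>)"
    by (auto simp: involutory_cayley_graph_def nat_pow_two cong: conj_cong)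
  then show ?thesis
    unfolding doubleton_eq_iff using swap by metis
qed

text \<open>
  The product \<open>w\<close> of the differences along two sides satisfies \<open>w\<^sup>2 = 1\<close>, and expanding the square of
  the third side gives \<open>2w = -1\<close>. So \<open>1 = (2w)\<^sup>2 = 4w\<^sup>2 = 4\<close>.
\<close>
lemma (in cring) three_eq_zero_if_triangle:
  assumes abc: "a \<in> carrier R" "b \<in> carrier R" "c \<in> carrier R"
    and ab: "(a \<ominus> b) \<otimes> (a \<ominus> b) = \<one>"
    and bc: "(b \<ominus> c) \<otimes> (b \<ominus> c) = \<one>"
    and ac: "(a \<ominus> c) \<otimes> (a \<ominus> c) = \<one>"
  shows "\<one> \<oplus> \<one> \<oplus> \<one> = \<zero>"
proof -
  define u v w where "u = a \<ominus> b" and "v = b \<ominus> c" and "w = u \<otimes> v"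
  have u: "u \<in> carrier R" and v: "v \<in> carrier R" and w: "w \<in> carrier R"
    using abc by (simp_all add: u_def v_def w_def)
  have sum: "a \<ominus> c = u \<oplus> v"
    unfolding u_def v_def using abc by algebra
  have "w \<oplus> w = (u \<oplus> v) \<otimes> (u \<oplus> v) \<ominus> u \<otimes> u \<ominus> v \<otimes> v"
    unfolding w_def using u v by algebra
  also have "\<dots> = \<ominus> \<one>"
    unfolding sum[symmetric] ab[folded u_def] bc[folded v_def] ac by (simp add: minus_eq r_neg)
  finally have double: "w \<oplus> w = \<ominus> \<one>" .
  have "w \<otimes> w = (u \<otimes> u) \<otimes> (v \<otimes> v)"
    unfolding w_def using u v by (simp add: m_ac)
  also have "\<dots> = \<one>"
    unfolding ab[folded u_def] bc[folded v_def] by simp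
  finally have square: "w \<otimes> w = \<one>" .
  have "(w \<oplus> w) \<otimes> (w \<oplus> w) = w \<otimes> w \<oplus> w \<otimes> w \<oplus> w \<otimes> w \<oplus> w \<otimes> w"
    using w by (simp add: l_distr r_distr a_assoc)
  then have "\<ominus> \<one> \<otimes> \<ominus> \<one> = \<one> \<oplus> \<one> \<oplus> \<one> \<oplus> \<one>"
    unfolding double square .
  then have "\<one> = (\<one> \<oplus> \<one> \<oplus> \<one>) \<oplus> \<one>"
    by (simp add: l_minus)
  then show ?thesis
    by (metis add.r_cancel_one' add.m_closed one_closed)
qed

lemma (in cring) clique_number_two:
  assumes "\<one> \<noteq> \<zero>" and "\<one> \<oplus> \<one> \<oplus> \<one> \<noteq> \<zero>"
  shows "clique_number (involutory_cayley_graph R) = 2"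
proof -
  let ?G = "involutory_cayley_graph R"
  have "{\<zero>, \<one>} \<subseteq> fst ?G" "card {\<zero>, \<one>} = 2"
    using assms by (auto simp: involutory_cayley_graph_def card_2_iff)
  moreover have "clique {\<zero>, \<one>} (snd ?G)"
    using assms by (auto simp: clique_def adjacent_iff minus_eq l_minus r_minus)
  moreover have "card C \<le> 2" if "clique C (snd ?G)" for C
  proof (rule ccontr)
    assume "\<not> card C \<le> 2"
    then obtain a b c where "{a, b, c} \<subseteq> C" "a \<noteq> b" "b \<noteq> c" "a \<noteq> c"
      by (metis card_3_iff obtain_subset_with_card_n not_less_eq_eq numeral_2_eq_2 numeral_3_eq_3)
    then have "{a, b} \<in> snd ?G" "{b, c} \<in> snd ?G" "{a, c} \<in> snd ?G"
      using that by (auto simp: clique_def)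
    then show False
      using three_eq_zero_if_triangle[of a b c] assms(2) unfolding adjacent_iff by blast
  qed
  ultimately have "clique_number ?G = enat 2"
    unfolding clique_number_eq_enat_iff by blast
  then show ?thesis
    by (simp add: numeral_eq_enat)
qed

text \<open>
  A domain has no zero divisors, so one factor of \<open>x\<^sup>2 - 1 = (x - 1)(x + 1)\<close> vanishes.
\<close>
lemma (in "domain") eq_pm_one_if_square_one:
  assumes "x \<in> carrier R" "x \<otimes> x = \<one>"
  shows "x = \<one> \<or> x = \<ominus> \<one>"
proof -
  have "(x \<ominus> \<one>) \<otimes> (x \<oplus> \<one>) = x \<otimes> x \<ominus> \<one>"
    using assms(1) by algebra
  also have "\<dots> = \<zero>"
    using assms(2) by (simp add: minus_eq r_neg)
  finally have "x \<ominus> \<one> = \<zero> \<or> x \<oplus> \<one> = \<zero>"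
    using assms(1) integral[of "x \<ominus> \<one>" "x \<oplus> \<one>"] by blast
  then show ?thesis
    using assms(1) minus_equality minus_unique r_right_minus_eq by blast
qed

text \<open>
  Every clique containing \<open>a\<close> is contained in the translate by \<open>a\<close> of the set \<open>{0, 1, -1}\<close>, which is
  itself a clique. Its three elements are distinct: \<open>1 = -1\<close> would mean \<open>2 = 0\<close>, which together
  with \<open>3 = 0\<close> gives \<open>1 = 0\<close>.
\<close>
lemma (in "domain") clique_number_three:
  assumes three: "\<one> \<oplus> \<one> \<oplus> \<one> = \<zero>"
  shows "clique_number (involutory_cayley_graph R) = 3"
proof -
  let ?G = "involutory_cayley_graph R"
  let ?T = "{\<zero>, \<one>, \<ominus> \<one>}"
  have "\<one> \<oplus> \<one> = \<ominus> \<one>"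
    using three by (simp add: minus_equality)
  then have opp: "\<ominus> \<one> \<oplus> \<ominus> \<one> = \<one>"
    by (metis minus_add minus_minus one_closed)
  have ne: "\<one> \<noteq> \<ominus> \<one>" "\<ominus> \<one> \<noteq> \<zero>"
    using three \<open>\<one> \<oplus> \<one> = \<ominus> \<one>\<close>
    by (metis add.l_cancel_one' one_closed one_not_zero, metis add.inv_eq_1_iff one_closed one_not_zero)
  have "?T \<subseteq> fst ?G"
    by (auto simp: involutory_cayley_graph_def)
  moreover have card_T: "card ?T = 3"
    using ne ne[symmetric] by simp
  moreover have "clique ?T (snd ?G)"
    unfolding clique_def ball_simps adjacent_iff minus_eq
    using ne ne[symmetric] by (simp add: l_minus r_minus \<open>\<one> \<oplus> \<one> = \<ominus> \<one>\<close> opp)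
  moreover have "card C \<le> 3" if C: "clique C (snd ?G)" "C \<subseteq> fst ?G" for C
  proof (cases "C = {}")
    case False
    then obtain a where "a \<in> C"
      by blast
    then have a: "a \<in> carrier R"
      using C(2) by (auto simp: involutory_cayley_graph_def)
    have "C \<subseteq> (\<lambda>t. t \<oplus> a) ` ?T"
    proof
      fix b assume "b \<in> C"
      then have b: "b \<in> carrier R"
        using C(2) by (auto simp: involutory_cayley_graph_def)
      have "b \<ominus> a \<in> ?T"
      proof (cases "a = b")
        case True
        then show ?thesis using a by (simp add: minus_eq r_neg)
      next
        case False
        then have "{b, a} \<in> snd ?G"
          using C(1) \<open>a \<in> C\<close> \<open>b \<in> C\<close> unfolding clique_def by metis
        then show ?thesis
          using eq_pm_one_if_square_one[of "b \<ominus> a"] a b unfolding adjacent_iff by auto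
      qed
      moreover have "b = (b \<ominus> a) \<oplus> a"
        using a b by algebra
      ultimately show "b \<in> (\<lambda>t. t \<oplus> a) ` ?T"
        by (rule rev_image_eqI)
    qed
    then have "card C \<le> card ?T"
      by (rule surj_card_le[rotated]) simp
    then show ?thesis
      using card_T by simp
  qed simp
  ultimately have "clique_number ?G = enat 3"
    unfolding clique_number_eq_enat_iff by blast
  then show ?thesis
    by (simp add: numeral_eq_enat)
qed

lemma (in UP_cring) UP_three_eq_zero_iff:
  "\<one>\<^bsub>P\<^esub> \<oplus>\<^bsub>P\<^esub> \<one>\<^bsub>P\<^esub> \<oplus>\<^bsub>P\<^esub> \<one>\<^bsub>P\<^esub> = \<zero>\<^bsub>P\<^esub> \<longleftrightarrow> \<one> \<oplus> \<one> \<oplus> \<one> = \<zero>"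
proof -
  have "\<one>\<^bsub>P\<^esub> \<oplus>\<^bsub>P\<^esub> \<one>\<^bsub>P\<^esub> \<oplus>\<^bsub>P\<^esub> \<one>\<^bsub>P\<^esub> = monom P (\<one> \<oplus> \<one> \<oplus> \<one>) 0"
    by simp
  moreover have "\<zero>\<^bsub>P\<^esub> = monom P \<zero> 0"
    by simp
  ultimately show ?thesis
    using inj_on_eq_iff[OF monom_inj, of "\<one> \<oplus> \<one> \<oplus> \<one>" \<zero> 0] by simp
qed

lemma (in UP_cring) UP_one_eq_zero_iff: "\<one>\<^bsub>P\<^esub> = \<zero>\<^bsub>P\<^esub> \<longleftrightarrow> \<one> = \<zero>"
  using inj_on_eq_iff[OF monom_inj, of \<one> \<zero> 0] by simp

theorem theorem3p7:
  fixes n :: int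
  assumes "n \<ge> 2"
  shows "clique_number (involutory_cayley_graph (UP (residue_ring n)))
           = clique_number (involutory_cayley_graph (residue_ring n))
       \<and> clique_number (involutory_cayley_graph (residue_ring n)) = (if n \<noteq> 3 then 2 else 3)"
proof -
  define R where "R = residue_ring n"
  interpret residues n R
    using assms by unfold_locales (simp_all add: R_def)
  interpret UP: UP_cring R "UP R"
    by unfold_locales simp
  have three: "\<one>\<^bsub>R\<^esub> \<oplus>\<^bsub>R\<^esub> \<one>\<^bsub>R\<^esub> \<oplus>\<^bsub>R\<^esub> \<one>\<^bsub>R\<^esub> = \<zero>\<^bsub>R\<^esub> \<longleftrightarrow> n = 3"
  proof -
    have "\<one>\<^bsub>R\<^esub> \<oplus>\<^bsub>R\<^esub> \<one>\<^bsub>R\<^esub> \<oplus>\<^bsub>R\<^esub> \<one>\<^bsub>R\<^esub> = 3 mod n"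
      by (simp add: res_one_eq res_add_eq mod_simps)
    moreover have "3 mod n = 0 \<longleftrightarrow> n = 3"
    proof (cases "n = 2 \<or> n = 3")
      case False
      with assms have "3 mod n = 3" by simp
      with False show ?thesis by simp
    qed auto
    ultimately show ?thesis
      by (simp add: res_zero_eq)
  qed
  have one: "\<one>\<^bsub>R\<^esub> \<noteq> \<zero>\<^bsub>R\<^esub>"
    by (simp add: res_zero_eq res_one_eq)
  show ?thesis
  proof (cases "n = 3")
    case True
    interpret residues_prime 3 R
      by unfold_locales (simp_all add: R_def True)
    interpret UPD: UP_domain R "UP R"
      by unfold_locales
    show ?thesis
      using clique_number_three UPD.clique_number_three UP.UP_three_eq_zero_iff three True
      by (simp add: R_def)
  next
    case False
    then show ?thesis
      using clique_number_two UP.P.clique_number_two UP.UP_three_eq_zero_iff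
        UP.UP_one_eq_zero_iff three one
      by (simp add: R_def)
  qed
qed

end
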